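(* Let $\mathcal{P}$ be a Poisson algebra of dimension $n$ over an arbitrary field $\mathbb{F}$. If $\alpha(\mathcal{P})=n-1$, then $\beta(\mathcal{P})=n-1$.
   Context: A Poisson algebra over a field $\mathbb{F}$ is an $\mathbb{F}$-vector space $\mathcal{P}$ with two bilinear multiplications, $\cdot$ (written by concatenation) and $[\cdot,\cdot]$, such that $(\mathcal{P},\cdot)$ is an associative commutative algebra (not necessarily unital), $(\mathcal{P},[\cdot,\cdot])$ is a Lie algebra, and $[xy,z]=[x,z]y+x[y,z]$ for all $x,y,z\in\mathcal{P}$. A subalgebra is a linear subspace closed under both multiplications; an ideal is a subspace $I$ with $I\cdot\mathcal{P}+[I,\mathcal{P}]\subseteq I$. A subalgebra (or ideal) $A$ is abelian if $A\cdot A+[A,A]=0$, i.e. both multiplications vanish on $A$. $\alpha(\mathcal{P})$ is the maximal dimension of an abelian subalgebra of $\mathcal{P}$, and $\beta(\mathcal{P})$ is the maximal dimension of an abelian ideal of $\mathcal{P}$. *)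

theory Defs
  imports Complex_Main
begin

text \<open>The algebra is the whole type \<open>'b\<close>. The commutative product need not be unital.\<close>

locale poisson_algebra = vector_space scale
  for scale :: "'a::field \<Rightarrow> 'b::ab_group_add \<Rightarrow> 'b" (infixr \<open>*s\<close> 75) +
  fixes mult :: "'b \<Rightarrow> 'b \<Rightarrow> 'b" (infixl \<open>\<cdot>\<close> 70)
    and bracket :: "'b \<Rightarrow> 'b \<Rightarrow> 'b" (\<open>\<lbrace>_, _\<rbrace>\<close>)
  assumes mult_linear_left: "Vector_Spaces.linear scale scale (\<lambda>x. x \<cdot> y)"
    and mult_linear_right: "Vector_Spaces.linear scale scale (\<lambda>y. x \<cdot> y)"
    and mult_assoc: "(x \<cdot> y) \<cdot> z = x \<cdot> (y \<cdot> z)"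
    and mult_commute: "x \<cdot> y = y \<cdot> x"
    and bracket_linear_left: "Vector_Spaces.linear scale scale (\<lambda>x. \<lbrace>x, y\<rbrace>)"
    and bracket_linear_right: "Vector_Spaces.linear scale scale (\<lambda>y. \<lbrace>x, y\<rbrace>)"
    and bracket_self: "\<lbrace>x, x\<rbrace> = 0"
    and jacobi: "\<lbrace>x, \<lbrace>y, z\<rbrace>\<rbrace> + \<lbrace>y, \<lbrace>z, x\<rbrace>\<rbrace> + \<lbrace>z, \<lbrace>x, y\<rbrace>\<rbrace> = 0"
    and leibniz: "\<lbrace>x \<cdot> y, z\<rbrace> = \<lbrace>x, z\<rbrace> \<cdot> y + x \<cdot> \<lbrace>y, z\<rbrace>"
begin

definition subalgebra :: "'b set \<Rightarrow> bool" where
  "subalgebra A \<longleftrightarrow> subspace A \<and> (\<forall>x\<in>A. \<forall>y\<in>A. x \<cdot> y \<in> A \<and> \<lbrace>x, y\<rbrace> \<in> A)"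

text \<open>One-sided conditions suffice below, by (anti)commutativity of the two products.\<close>

definition poisson_ideal :: "'b set \<Rightarrow> bool" where
  "poisson_ideal I \<longleftrightarrow> subspace I \<and> (\<forall>x\<in>I. \<forall>y. x \<cdot> y \<in> I \<and> \<lbrace>x, y\<rbrace> \<in> I)"

definition abelian :: "'b set \<Rightarrow> bool" where
  "abelian A \<longleftrightarrow> (\<forall>x\<in>A. \<forall>y\<in>A. x \<cdot> y = 0 \<and> \<lbrace>x, y\<rbrace> = 0)"

text \<open>
  The two maxima are meaningful for finite-dimensional algebras: the sets are then finite, and
  they contain \<open>0\<close>, the dimension of the zero ideal.
\<close>

definition alpha :: nat where
  "alpha = Max {dim A |A. subalgebra A \<and> abelian A}"

definition beta :: nat where
  "beta = Max {dim I |I. poisson_ideal I \<and> abelian I}"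

end

end

theory Submission
  imports Defs
begin

text \<open>
  Let \<open>A\<close> be an abelian subalgebra of codimension one that is not an ideal. Associativity makes \<open>A\<close>
  an ideal for the product, so the bracket leaves \<open>A\<close>: after rescaling there are \<open>a \<in> A\<close> and
  \<open>f \<notin> A\<close> with \<open>\<lbrace>a, f\<rbrace> = f\<close>. By the Jacobi identity \<open>f\<close> is a common eigenvector of the maps
  \<open>\<lbrace>x, _\<rbrace>\<close> with \<open>x \<in> A\<close>, and the Leibniz rule forces \<open>f \<cdot> f = 0\<close> and \<open>k \<cdot> f = 0\<close> for all \<open>k\<close> in the
  kernel \<open>K\<close> of the eigenvalue functional. Hence \<open>K\<close> and \<open>f\<close> together span an abelian ideal, and
  adding \<open>a\<close> recovers the whole algebra.
\<close>

context poisson_algebra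
begin

interpretation mult_left: Vector_Spaces.linear scale scale "\<lambda>x. x \<cdot> y" for y
  by (rule mult_linear_left)

interpretation mult_right: Vector_Spaces.linear scale scale "\<lambda>y. x \<cdot> y" for x
  by (rule mult_linear_right)

interpretation bracket_left: Vector_Spaces.linear scale scale "\<lambda>x. \<lbrace>x, y\<rbrace>" for y
  by (rule bracket_linear_left)

interpretation bracket_right: Vector_Spaces.linear scale scale "\<lambda>y. \<lbrace>x, y\<rbrace>" for x
  by (rule bracket_linear_right)

lemmas mult_simps =
  mult_left.add mult_right.add mult_left.scale mult_right.scale

lemmas bracket_simps =
  bracket_left.add bracket_right.add bracket_left.scale bracket_right.scale

lemma bracket_anticommute: "\<lbrace>y, x\<rbrace> = - \<lbrace>x, y\<rbrace>"
proof -
  have "\<lbrace>y, x\<rbrace> + \<lbrace>x, y\<rbrace> = \<lbrace>x + y, x + y\<rbrace>"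
    by (simp only: bracket_simps) (simp add: bracket_self add.commute)
  then have "\<lbrace>y, x\<rbrace> + \<lbrace>x, y\<rbrace> = 0" by (simp add: bracket_self)
  then show ?thesis by (simp add: eq_neg_iff_add_eq_0)
qed

lemma zero_ideal: "poisson_ideal {0}" and abelian_zero: "abelian {0}"
  by (auto simp: poisson_ideal_def abelian_def)

text \<open>Multiplying \<open>a \<cdot> e = b + c *s e\<close> by \<open>a\<close> kills the left
  side by associativity and kills \<open>a \<cdot> b\<close>, leaving
  \<open>c *s (a \<cdot> e) = 0\<close>. Either factor being zero puts \<open>a \<cdot> e\<close>
  into \<open>A\<close>.\<close>

lemma abelian_subalgebra_mult_closed:
  assumes sub: "subspace A" and ab: "abelian A" and dec: "\<And>x. \<exists>a\<in>A. \<exists>c. x = a + c *s e"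
    and a: "a \<in> A"
  shows "a \<cdot> x \<in> A"
proof -
  obtain b c where b: "b \<in> A" and eq: "a \<cdot> e = b + c *s e" using dec by blast
  have "0 = a \<cdot> (a \<cdot> e)"
    using ab a by (simp add: abelian_def mult_assoc[symmetric] mult_simps)
  also have "\<dots> = c *s (a \<cdot> e)"
    using ab a b by (subst eq) (simp add: mult_simps abelian_def)
  finally have "c = 0 \<or> a \<cdot> e = 0" by (metis scale_eq_0_iff)
  then have ae: "a \<cdot> e \<in> A" using eq b subspace_0[OF sub] by auto
  obtain d r where "d \<in> A" "x = d + r *s e" using dec by blast
  then show ?thesis
    using ab a ae sub by (simp add: mult_simps abelian_def subspace_scale)
qed

text \<open>Codimension at most one is expressed by spanning, so the argument needs no finite
  dimension.\<close>

lemma abelian_ideal_codim_one: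
  assumes sub: "subspace A" and ab: "abelian A" and dec: "\<And>x. \<exists>a\<in>A. \<exists>c. x = a + c *s e"
  obtains I a where "poisson_ideal I" "abelian I" "span (insert a I) = UNIV"
proof (cases "poisson_ideal A")
  case True
  have "x \<in> span (insert e A)" for x
    using dec[of x] by (auto intro!: span_add span_scale intro: span_base)
  then show ?thesis using that[OF True ab] by blast
next
  case False
  have closed: "a \<cdot> x \<in> A" if "a \<in> A" for a x
    using abelian_subalgebra_mult_closed[OF sub ab dec that] .
  have AA: "x \<cdot> y = 0" "\<lbrace>x, y\<rbrace> = 0" if "x \<in> A" "y \<in> A" for x y
    using ab that by (auto simp: abelian_def)
  obtain a' x where a': "a' \<in> A" and notin: "\<lbrace>a', x\<rbrace> \<notin> A"
    using False sub closed by (auto simp: poisson_ideal_def)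
  obtain b0 c0 where b0: "b0 \<in> A" and x: "x = b0 + c0 *s e" using dec by blast
  have a'e: "\<lbrace>a', e\<rbrace> \<notin> A"
    using notin AA[OF a' b0] sub by (auto simp: x bracket_simps subspace_scale)
  obtain b c where b: "b \<in> A" and eq: "\<lbrace>a', e\<rbrace> = b + c *s e" using dec by blast
  have c: "c \<noteq> 0" using a'e b eq by auto
  \<comment> \<open>Here \<open>f\<close> is \<open>\<lbrace>a, e\<rbrace>\<close>. It differs from
    \<open>e\<close> by an element of \<open>A\<close>, which \<open>a\<close> annihilates, so
    bracketing with \<open>a\<close> fixes \<open>f\<close>.\<close>
  define a where "a = inverse c *s a'"
  define f where "f = inverse c *s b + e"
  have a: "a \<in> A" unfolding a_def by (rule subspace_scale[OF sub a'])
  have af: "\<lbrace>a, f\<rbrace> = f"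
    using c AA(2)[OF a' b] by (simp add: a_def f_def bracket_simps eq scale_right_distrib)
  have decf: "\<exists>a\<in>A. \<exists>c. x = a + c *s f" for x
  proof -
    obtain d r where "d \<in> A" "x = d + r *s e" using dec by blast
    then have "x = (d - r *s inverse c *s b) + r *s f" "d - r *s inverse c *s b \<in> A"
      using b sub by (simp_all add: f_def scale_right_distrib subspace_scale subspace_diff
        del: scale_scale)
    then show ?thesis by blast
  qed
  \<comment> \<open>Brackets with \<open>a\<close> and with \<open>y\<close> commute by Jacobi, so
    \<open>a\<close> fixes \<open>\<lbrace>y, f\<rbrace>\<close>; but \<open>a\<close> also kills
    its component in \<open>A\<close>.\<close>
  have eigen: "\<exists>m. \<lbrace>y, f\<rbrace> = m *s f" if y: "y \<in> A" for y
  proof -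
    obtain d m where d: "d \<in> A" and yf: "\<lbrace>y, f\<rbrace> = d + m *s f" using decf by blast
    have "\<lbrace>a, \<lbrace>y, f\<rbrace>\<rbrace> = \<lbrace>y, \<lbrace>a, f\<rbrace>\<rbrace>"
    proof -
      have "\<lbrace>y, \<lbrace>f, a\<rbrace>\<rbrace> = - \<lbrace>y, \<lbrace>a, f\<rbrace>\<rbrace>"
        by (subst bracket_anticommute[of f a]) (rule bracket_right.neg)
      then show ?thesis
        using jacobi[of a y f] AA(2)[OF a y] by (simp add: bracket_simps)
    qed
    then show ?thesis
      using AA(2)[OF a d] by (auto simp: yf af bracket_simps)
  qed
  define K where "K = {y \<in> A. \<lbrace>y, f\<rbrace> = 0}"
  have K: "subspace K"
    using sub by (auto simp: K_def subspace_def bracket_simps)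
  have KA: "k \<in> A" "\<lbrace>k, f\<rbrace> = 0" "\<lbrace>f, k\<rbrace> = 0" if "k \<in> K" for k
    using that bracket_anticommute[of f k] by (auto simp: K_def)
  \<comment> \<open>Expand the bracket of \<open>a \<cdot> k = 0\<close> with
    \<open>f\<close>.\<close>
  have Kf: "k \<cdot> f = 0" "f \<cdot> k = 0" if k: "k \<in> K" for k
  proof -
    have "\<lbrace>a \<cdot> k, f\<rbrace> = f \<cdot> k"
      using leibniz[of a k f] KA[OF k] by (simp add: af mult_simps)
    then show "f \<cdot> k = 0" using AA(1)[OF a KA(1)[OF k]] by (simp add: bracket_simps)
    then show "k \<cdot> f = 0" by (simp add: mult_commute)
  qed
  \<comment> \<open>Since \<open>a \<cdot> f\<close> lies in \<open>A\<close>, its bracket with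
    \<open>f\<close>, which is \<open>f \<cdot> f\<close>, is a multiple of \<open>f\<close> and
    hence fixed by \<open>a\<close>. Leibniz says that \<open>a\<close> doubles it, so it vanishes
    in every characteristic.\<close>
  have ff: "f \<cdot> f = 0"
  proof -
    obtain m where m: "\<lbrace>a \<cdot> f, f\<rbrace> = m *s f" using eigen[OF closed[OF a]] by blast
    then have sq: "f \<cdot> f = m *s f"
      by (simp add: leibniz af bracket_self mult_simps)
    have "\<lbrace>a, f \<cdot> f\<rbrace> = m *s f" by (simp add: sq bracket_simps af)
    moreover have "\<lbrace>a, f \<cdot> f\<rbrace> = f \<cdot> f + f \<cdot> f"
    proof -
      have "\<lbrace>a, f \<cdot> f\<rbrace> = - \<lbrace>f \<cdot> f, a\<rbrace>" by (rule bracket_anticommute)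
      also have "\<dots> = - (- f \<cdot> f + f \<cdot> - f)"
        by (simp add: leibniz bracket_anticommute[of f a] af)
      also have "\<dots> = f \<cdot> f + f \<cdot> f"
        by (simp add: mult_left.neg mult_right.neg)
      finally show ?thesis .
    qed
    ultimately show ?thesis using sq by simp
  qed
  have Af: "y \<cdot> f \<in> K" if y: "y \<in> A" for y
  proof -
    obtain m where "\<lbrace>y, f\<rbrace> = m *s f" using eigen[OF y] by blast
    then show ?thesis
      using closed[OF y] by (simp add: K_def leibniz bracket_self mult_simps ff)
  qed
  define I where "I = {k + r *s f |k r. k \<in> K}"
  have "span (insert f K) = I"
  proof (intro set_eqI iffI)
    fix x assume "x \<in> span (insert f K)"
    then obtain r where "x - r *s f \<in> K" using span_eq_iff[THEN iffD2, OF K] by (auto simp: span_insert)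
    then show "x \<in> I" unfolding I_def by (intro CollectI exI[of _ "x - r *s f"] exI[of _ r]) simp
  next
    fix x assume "x \<in> I"
    then obtain k r where "k \<in> K" "x = k + r *s f" by (auto simp: I_def)
    then show "x \<in> span (insert f K)" by (simp add: span_add span_scale span_base)
  qed
  then have subI: "subspace I" using subspace_span by metis
  have KI: "k \<in> I" if "k \<in> K" for k
    unfolding I_def using that by (intro CollectI exI[of _ k] exI[of _ 0]) simp
  have fI: "r *s f \<in> I" for r
    unfolding I_def using subspace_0[OF K] by force
  have ideal: "poisson_ideal I"
    unfolding poisson_ideal_def
  proof (intro conjI ballI allI subI)
    fix x y assume "x \<in> I"
    then obtain k r where k: "k \<in> K" and x: "x = k + r *s f" by (auto simp: I_def)
    obtain d s where d: "d \<in> A" and y: "y = d + s *s f" using decf by blast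
    obtain m where m: "\<lbrace>d, f\<rbrace> = m *s f" using eigen[OF d] by blast
    \<comment> \<open>All other products vanish, and \<open>Af\<close> puts this one into
      \<open>K\<close>.\<close>
    have "x \<cdot> y = r *s (d \<cdot> f)"
      using AA(1)[OF KA(1)[OF k] d] Kf[OF k]
      by (simp add: x y mult_simps ff mult_commute[of f d])
    then show "x \<cdot> y \<in> I" using KI Af[OF d] subI by (simp add: subspace_scale)
    have "\<lbrace>x, y\<rbrace> = - ((r * m) *s f)"
      using AA(2)[OF KA(1)[OF k] d] KA[OF k]
      by (simp add: x y bracket_simps bracket_self bracket_anticommute[of f d] m)
    then show "\<lbrace>x, y\<rbrace> \<in> I" using subI fI by (simp add: subspace_neg)
  qed
  have abI: "abelian I"
    unfolding abelian_def I_def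
    using AA KA Kf by (auto simp: mult_simps bracket_simps ff bracket_self)
  have "x \<in> span (insert a I)" for x
  proof -
    obtain d s where d: "d \<in> A" and x: "x = d + s *s f" using decf by blast
    obtain m where m: "\<lbrace>d, f\<rbrace> = m *s f" using eigen[OF d] by blast
    \<comment> \<open>As \<open>a\<close> has eigenvalue 1, subtracting \<open>m *s a\<close>
      cancels the eigenvalue of \<open>d\<close>.\<close>
    have "d - m *s a \<in> K"
      using d a sub m
      by (simp add: K_def subspace_diff subspace_scale bracket_simps af
          bracket_left.diff)
    then have "(d - m *s a) + s *s f \<in> I" by (auto simp: I_def)
    then have "(d - m *s a) + s *s f \<in> span (insert a I)" by (simp add: span_base)
    then have "m *s a + ((d - m *s a) + s *s f) \<in> span (insert a I)"
      by (rule span_add[OF span_scale[OF span_base[OF insertI1]]])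
    then show ?thesis by (simp add: x)
  qed
  then show ?thesis using that[OF ideal abI] by blast
qed

end

theorem lemma4p1:
  fixes scale :: "'a::field \<Rightarrow> 'b::ab_group_add \<Rightarrow> 'b"
    and mult bracket :: "'b \<Rightarrow> 'b \<Rightarrow> 'b"
    and Basis :: "'b set"
    and n :: nat
  assumes "poisson_algebra scale mult bracket"
    and "finite_dimensional_vector_space scale Basis"
    and "vector_space.dim scale (UNIV :: 'b set) = n"
    and "int (poisson_algebra.alpha scale mult bracket) = int n - 1"
  shows "int (poisson_algebra.beta scale mult bracket) = int n - 1"
proof -
  interpret poisson_algebra scale mult bracket by fact
  interpret finite_dimensional_vector_space scale Basis by fact
  let ?S = "{dim A |A. subalgebra A \<and> abelian A}"
  let ?T = "{dim I |I. poisson_ideal I \<and> abelian I}"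
  have n: "dim (UNIV :: 'b set) = n" by fact
  have TS: "?T \<subseteq> ?S" by (auto simp: poisson_ideal_def subalgebra_def)
  have "?S \<subseteq> {..n}" using dim_subset[OF subset_UNIV] n by auto
  then have finS: "finite ?S" by (rule finite_subset) simp
  then have finT: "finite ?T" by (rule finite_subset[OF TS])
  \<comment> \<open>Finite and nonempty sets make both maxima genuine, so \<open>alpha\<close> is
    attained.\<close>
  have neT: "?T \<noteq> {}" using zero_ideal abelian_zero by blast
  have "alpha \<in> ?S" unfolding alpha_def using Max_in[OF finS] neT TS by blast
  then obtain A where A: "subspace A" "abelian A" and dimA: "dim A = alpha"
    by (auto simp: subalgebra_def)
  \<comment> \<open>The integer equation rules out \<open>n = 0\<close>.\<close>
  have Suc: "Suc alpha = n" using assms(4) by linarith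
  then obtain e where e: "e \<notin> A" using dimA n by (metis UNIV_eq_I n_not_Suc_n)
  have spanA: "span A = A" using A(1) by simp
  have "dim (insert e A) = n" using Suc e by (simp add: dim_insert spanA dimA)
  then have full: "span (insert e A) = UNIV" using n dim_eq_span[OF subset_UNIV, of "insert e A"] by simp
  have dec: "\<exists>a\<in>A. \<exists>c. x = a + scale c e" for x
  proof -
    have "x \<in> span (insert e A)" using full by simp
    then obtain c where "x - scale c e \<in> A" by (auto simp: span_insert spanA)
    then show ?thesis by (intro bexI[of _ "x - scale c e"] exI[of _ c]) auto
  qed
  obtain I a where I: "poisson_ideal I" "abelian I" and spanI: "span (insert a I) = UNIV"
    using abelian_ideal_codim_one[OF A dec] by blast
  \<comment> \<open>One extra generator raises the dimension by at most one, so \<open>beta\<close>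
    is at least \<open>alpha\<close>; the reverse bound holds because abelian ideals are abelian
    subalgebras.\<close>
  have "n = dim (insert a I)" using n dim_span[of "insert a I"] spanI by simp
  then have "n \<le> Suc (dim I)" by (simp add: dim_insert split: if_splits)
  moreover have "dim I \<le> beta" unfolding beta_def using finT I by (intro Max_ge) auto
  moreover have "beta \<le> alpha"
    unfolding alpha_def beta_def by (rule Max_mono[OF TS neT finS])
  ultimately show ?thesis using Suc by linarith
qed

end
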